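(* Let $n\ge 0$ and $m>1$ be integers. Then $$sp(nm+1,m)=sp(nm+2,m)=\cdots=sp(nm+m-1,m)=1+2\sum_{j=1}^{n} sp(j,m).$$
   Context: For fixed $m>1$, $sp(n,m)$ is defined by: $sp(n,m)=0$ for $n<0$, $sp(0,m)=1$, $sp(n,m)=1$ for $1\le n\le m-1$, and for $n\ge m$: $sp(n,m)=sp(n/m,m)$ if $m\mid n$, and $sp(n,m)=2sp(n-r,m)+sp(n-m,m)$ if $n\equiv r\pmod m$ with $0<r<m$. (It counts semi-$m$-Pell compositions of $n$.) *)

theory Defs
  imports Complex_Main
begin

text \<open>
  The index \<open>n\<close> is an integer, so that the convention that the value is 0 for negative \<open>n\<close>
  can be stated literally. For \<open>m \<le> 1\<close> the function is not meaningful and the value 0 is a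
  dummy that makes it total. In the last branch \<open>n mod m\<close> is the residue \<open>r\<close> with \<open>0 < r < m\<close>.
\<close>

function sp :: "int \<Rightarrow> int \<Rightarrow> nat" where
  "sp n m =
     (if m \<le> 1 then 0
      else if n < 0 then 0
      else if n = 0 then 1
      else if n \<le> m - 1 then 1
      else if m dvd n then sp (n div m) m
      else 2 * sp (n - n mod m) m + sp (n - m) m)"
  by pat_completeness auto
termination
proof (relation "measure (\<lambda>(n, m). nat n)", goal_cases)
  case 1
  show ?case by simp
next
  case (2 n m)
  then have "n div m < n" by (intro int_div_less_self) auto
  with 2 show ?case by simp
next
  case (3 n m)
  then have "n mod m > 0"
    by (metis dvd_eq_mod_eq_0 order_le_less pos_mod_sign not_le zless_add1_eq zero_less_one less_trans)
  with 3 show ?case by simp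
next
  case (4 n m)
  then show ?case by simp
qed

declare sp.simps [simp del]

lemma sp_neg: "m > 1 \<Longrightarrow> n < 0 \<Longrightarrow> sp n m = 0"
  by (simp add: sp.simps)

lemma sp_0: "m > 1 \<Longrightarrow> sp 0 m = 1"
  by (simp add: sp.simps)

lemma sp_small: "m > 1 \<Longrightarrow> 1 \<le> n \<Longrightarrow> n \<le> m - 1 \<Longrightarrow> sp n m = 1"
  by (simp add: sp.simps)

lemma sp_dvd: "m > 1 \<Longrightarrow> n \<ge> m \<Longrightarrow> m dvd n \<Longrightarrow> sp n m = sp (n div m) m"
  by (subst sp.simps) simp

lemma sp_not_dvd:
  assumes "m > 1" "n \<ge> m" "n mod m = r mod m" "0 < r" "r < m"
  shows "sp n m = 2 * sp (n - r) m + sp (n - m) m"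
proof -
  have "n mod m = r" using assms by simp
  moreover from this have "\<not> m dvd n" using assms by auto
  ultimately show ?thesis using assms by (subst sp.simps) simp
qed

end

theory Submission
  imports Defs
begin

text \<open>Fix the residue \<open>r\<close>. The non-divisible case of the recurrence reduces
  \<open>(i + 1) * m + r\<close> to \<open>(i + 1) * m\<close> and \<open>i * m + r\<close>, and the
  divisible case turns the former into \<open>i + 1\<close>. Hence raising \<open>n\<close> by one
  adds \<open>2 * sp (n + 1) m\<close>, whatever \<open>r\<close> is (\<open>sp_step\<close>). The
  initial value \<open>sp r m\<close> is 1 for every \<open>r\<close>, so the increments add up to
  the sum.\<close>

lemma sp_step:
  fixes i m r :: int
  assumes "i \<ge> 0" "m > 1" "0 < r" "r < m"
  shows "sp ((i + 1) * m + r) m = 2 * sp (i + 1) m + sp (i * m + r) m"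
proof -
  have "0 \<le> i * m" using assms by simp
  then have ge: "(i + 1) * m \<ge> m" by (simp add: distrib_right)
  have "sp ((i + 1) * m + r) m
      = 2 * sp ((i + 1) * m + r - r) m + sp ((i + 1) * m + r - m) m"
  proof (rule sp_not_dvd)
    show "(i + 1) * m + r \<ge> m" using ge assms by linarith
  qed (use assms in simp_all)
  moreover have "sp ((i + 1) * m) m = sp (i + 1) m"
    \<comment> \<open>\<open>ge\<close> ensures that the argument is past the initial values, where
      division by \<open>m\<close> applies.\<close>
    using sp_dvd[of m "(i + 1) * m"] assms ge by simp
  moreover have "(i + 1) * m + r - m = i * m + r"
    by (simp add: distrib_right)
  ultimately show ?thesis by simp
qed

theorem theorem3p5:
  fixes n m :: int
  assumes "n \<ge> 0" and "m > 1"
  shows "\<forall>r\<in>{1..m - 1}. sp (n * m + r) m = 1 + 2 * (\<Sum>j=1..n. sp j m)"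
proof
  fix r assume r: "r \<in> {1..m - 1}"
  show "sp (n * m + r) m = 1 + 2 * (\<Sum>j=1..n. sp j m)"
    using assms(1)
  proof (induction n rule: int_ge_induct)
    case base
    show ?case using r assms(2) by (simp add: sp_small)
  next
    case (step i)
    \<comment> \<open>Splitting off the top index needs \<open>i \<ge> 0\<close>: integer intervals
      may be empty.\<close>
    have "{1..i + 1} = insert (i + 1) {1..i}" using step.hyps by auto
    then show ?case using sp_step[of i m r] step assms(2) r by simp
  qed
qed

end
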